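(* Let $p$ and $\alpha$ be real numbers such that either $p \geq 1.35$ and $0 \leq \alpha \leq 1$, or $p > 1$ and $1/p \leq \alpha \leq 1$. Then for every complex sequence ${\bf a} = (a_n)_{n\geq 1} \in l^p$, $$\sum^{\infty}_{n=1}\left|\frac{1}{\sum^n_{i=1} i^{\alpha}}\sum^n_{i=1} i^{\alpha} a_i\right|^p \leq \left(\frac{(\alpha+1)p}{(\alpha+1)p-1}\right)^p \sum^{\infty}_{n=1}|a_n|^p.$$
   Context: For $p>1$, $l^p$ denotes the Banach space of all complex sequences ${\bf a}=(a_n)_{n\geq 1}$ with $\|{\bf a}\|_p = \left(\sum_{n=1}^\infty |a_n|^p\right)^{1/p} < \infty$. *)

theory Defs
  imports "HOL-Analysis.Analysis"
begin

text \<open>A sequence $(a_n)_{n \ge 1}$ is a function on \<^typ>\<open>nat\<close> of which only the values at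
  positive arguments are used; the value at \<open>0\<close> is irrelevant. Since all terms are nonnegative,
  unordered summability over \<open>{1..}\<close> agrees with convergence of the series.\<close>

definition lp_seq :: "real \<Rightarrow> (nat \<Rightarrow> complex) set" where
  "lp_seq p = {a. (\<lambda>n. cmod (a n) powr p) summable_on {1..}}"

definition weighted_mean :: "real \<Rightarrow> (nat \<Rightarrow> complex) \<Rightarrow> nat \<Rightarrow> complex" where
  "weighted_mean \<alpha> a n =
     1 / of_real (\<Sum>i=1..n. real i powr \<alpha>) * (\<Sum>i=1..n. of_real (real i powr \<alpha>) * a i)"

end

theory Submission imports Defs begin

text \<open>
  Let \<open>r\<^sub>n = \<Lambda>\<^sub>n / \<lambda>\<^sub>n\<close> with \<open>\<lambda>\<^sub>n = n\<^sup>\<alpha>\<close> and \<open>\<Lambda>\<^sub>n = \<lambda>\<^sub>1 + \<dots> + \<lambda>\<^sub>n\<close>, and let \<open>l = 1 / ((\<alpha> + 1) p)\<close>.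
  Hoelder's inequality with auxiliary weights \<open>w\<close> whose partial sums \<open>W\<close> satisfy
  \<open>(1 - l) W\<^sub>n = (r\<^sub>n - l) w\<^sub>n\<close>, followed by summation by parts, gives the operator norm bound
  \<open>1 / (1 - l)\<close> as soon as \<open>r\<^bsub>n+1\<^esub> - l \<le> r\<^sub>n (1 - l / r\<^sub>n) powr (1 - p)\<close>. This condition weakens
  Cartlidge's \<open>r\<^bsub>n+1\<^esub> - r\<^sub>n \<le> 1 / (\<alpha> + 1)\<close>, which fails for \<open>0 < \<alpha> < 1\<close>.

  With \<open>y = 1 / ((\<alpha> + 1) r\<^sub>n)\<close> and \<open>t = (1 + 1/n) powr (-\<alpha>)\<close> the condition becomes
  \<open>t + (1 + \<alpha> - 1/p) y \<le> (1 - y/p) powr (1 - p)\<close>, where \<open>y \<le> t/n\<close> by the Levin--Stechkin inequality.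
  For \<open>p \<ge> 1.35\<close> it follows from Taylor expansions of both powers. For smaller \<open>p\<close> the quantity
  \<open>(1 - u y) powr (1 - 1/u) + u y\<close> decreases in \<open>u = 1/p\<close>, which reduces the claim to \<open>u = \<alpha>\<close>, where
  it is an instance of Bernoulli's inequality.
\<close>

section \<open>Weighted Hoelder inequality, summation by parts and a criterion for weighted
  means\<close>

text \<open>Convexity of the power function: the tangent at \<open>m\<close> lies below the graph.
  This is Young's inequality for \<open>z powr p\<close> and \<open>m powr p\<close> with weights
  \<open>1 / p\<close> and \<open>1 - 1 / p\<close>; it is applied to positive numbers, hence the
  split at \<open>z = 0\<close>.\<close>

lemma powr_ge_tangent:
  fixes m z p :: real
  assumes "p > 1" "m > 0" "z \<ge> 0"
  shows "m powr p + p * m powr (p - 1) * (z - m) \<le> z powr p"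
proof (cases "z = 0")
  case True
  then show ?thesis
    using assms by (simp add: powr_mult_base powr_diff)
next
  case False
  then have "(z powr p) powr (1 / p) * (m powr p) powr (1 - 1 / p) \<le> 1 / p * z powr p + (1 - 1 / p) * m powr p"
    using assms by (intro Youngs_inequality_0) auto
  moreover have "(m powr p) powr (1 - 1 / p) = m powr (p - 1)"
    using assms by (simp add: powr_powr algebra_simps)
  ultimately have "z * m powr (p - 1) \<le> 1 / p * z powr p + (1 - 1 / p) * m powr p"
    using assms False by (simp add: powr_powr)
  then have "p * (z * m powr (p - 1)) \<le> p * (1 / p * z powr p + (1 - 1 / p) * m powr p)"
    using assms by (intro mult_left_mono) auto
  also have "\<dots> = z powr p + (p - 1) * m powr p"
    using assms by (simp add: field_simps)
  finally have "p * (z * m powr (p - 1)) \<le> z powr p + (p - 1) * m powr p" .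
  moreover have "m powr (p - 1) * m = m powr p"
    using assms by (simp add: powr_diff)
  ultimately show ?thesis
    by (simp add: algebra_simps)
qed

text \<open>Hoelder's inequality in Jensen form: the tangent bounds at the weighted mean
  \<open>m = S / W\<close> of the quotients \<open>x i / w i\<close> are summed with weights
  \<open>w i\<close>, and the linear terms cancel.\<close>

lemma sum_powr_le_weighted:
  fixes x w :: "'a \<Rightarrow> real"
  assumes "p > 1" "finite I" "\<And>i. i \<in> I \<Longrightarrow> x i \<ge> 0" "\<And>i. i \<in> I \<Longrightarrow> w i > 0"
  shows "(\<Sum>i\<in>I. x i) powr p \<le> (\<Sum>i\<in>I. w i) powr (p - 1) * (\<Sum>i\<in>I. x i powr p * w i powr (1 - p))"
proof (cases "(\<Sum>i\<in>I. x i) = 0")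
  case True
  then show ?thesis
    using assms by (auto intro!: mult_nonneg_nonneg sum_nonneg)
next
  case False
  define S W m where "S = (\<Sum>i\<in>I. x i)" and "W = (\<Sum>i\<in>I. w i)" and "m = S / W"
  have "S > 0"
    using False assms sum_nonneg[of I x] by (auto simp: S_def less_le)
  moreover have "W > 0"
    using False assms by (auto simp: W_def intro!: sum_pos)
  ultimately have "m > 0" "m * W = S"
    by (auto simp: m_def)
  have "w i * m powr p + p * m powr (p - 1) * (x i - m * w i) \<le> x i powr p * w i powr (1 - p)"
    if "i \<in> I" for i
  proof -
    have "w i > 0" "x i \<ge> 0" using assms that by auto
    have "w i * (m powr p + p * m powr (p - 1) * (x i / w i - m)) \<le> w i * (x i / w i) powr p"
      using \<open>w i > 0\<close> \<open>x i \<ge> 0\<close> \<open>m > 0\<close> assms by (intro mult_left_mono powr_ge_tangent) auto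
    moreover have "w i * (x i / w i) powr p = x i powr p * w i powr (1 - p)"
      using \<open>w i > 0\<close> \<open>x i \<ge> 0\<close> by (simp add: powr_divide powr_diff)
    moreover have "w i * (m powr p + p * m powr (p - 1) * (x i / w i - m)) =
        w i * m powr p + p * m powr (p - 1) * (x i - m * w i)"
      using \<open>w i > 0\<close> by (simp add: field_simps)
    ultimately show ?thesis by simp
  qed
  then have "(\<Sum>i\<in>I. w i * m powr p + p * m powr (p - 1) * (x i - m * w i))
      \<le> (\<Sum>i\<in>I. x i powr p * w i powr (1 - p))"
    by (rule sum_mono)
  also have "(\<Sum>i\<in>I. w i * m powr p + p * m powr (p - 1) * (x i - m * w i)) =
      W * m powr p + p * m powr (p - 1) * (S - m * W)"
    by (simp add: sum.distrib sum_subtractf S_def W_def flip: sum_distrib_left sum_distrib_right)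
  finally have "W * m powr p \<le> (\<Sum>i\<in>I. x i powr p * w i powr (1 - p))"
    using \<open>m * W = S\<close> by simp
  then have "W powr (p - 1) * (W * m powr p) \<le> W powr (p - 1) * (\<Sum>i\<in>I. x i powr p * w i powr (1 - p))"
    by (intro mult_left_mono) auto
  moreover have "W powr (p - 1) * (W * m powr p) = S powr p"
    using \<open>W > 0\<close> \<open>S > 0\<close> by (simp add: m_def powr_divide powr_diff)
  ultimately show ?thesis
    by (simp add: S_def W_def)
qed

text \<open>Abel summation; the boundary term at \<open>Suc N\<close> is nonnegative and is
  dropped.\<close>

lemma sum_le_of_telescoping_bound:
  fixes c d f b :: "nat \<Rightarrow> real"
  assumes "C \<ge> 0" "\<And>n. c n \<ge> 0" "\<And>n. d n \<ge> 0"
    and "\<And>n. f n \<le> C * (d n - d (Suc n)) * (\<Sum>k\<le>n. c k)"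
  shows "(\<Sum>n\<le>N. f n) \<le> C * (\<Sum>n\<le>N. c n * d n)"
proof -
  have "(\<Sum>n\<le>N. (d n - d (Suc n)) * (\<Sum>k\<le>n. c k)) + d (Suc N) * (\<Sum>k\<le>N. c k) = (\<Sum>n\<le>N. c n * d n)"
    by (induction N) (auto simp: algebra_simps)
  moreover have "d (Suc N) * (\<Sum>k\<le>N. c k) \<ge> 0"
    using assms by (auto intro!: mult_nonneg_nonneg sum_nonneg)
  ultimately have "(\<Sum>n\<le>N. (d n - d (Suc n)) * (\<Sum>k\<le>n. c k)) \<le> (\<Sum>n\<le>N. c n * d n)"
    by linarith
  then have "C * (\<Sum>n\<le>N. (d n - d (Suc n)) * (\<Sum>k\<le>n. c k)) \<le> C * (\<Sum>n\<le>N. c n * d n)"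
    using assms by (intro mult_left_mono) auto
  moreover have "(\<Sum>n\<le>N. f n) \<le> (\<Sum>n\<le>N. C * ((d n - d (Suc n)) * (\<Sum>k\<le>n. c k)))"
    using assms by (intro sum_mono) (simp add: mult.assoc)
  ultimately show ?thesis
    by (simp add: sum_distrib_left)
qed

text \<open>Sequences start at index 0 here, so \<open>r 0 = 1\<close>. The hypothesis on
  \<open>r\<close> is exactly what makes the Hoelder factors bounded by the differences of
  \<open>d\<close>, as summation by parts demands.\<close>

lemma weighted_mean_sum_le:
  fixes L b :: "nat \<Rightarrow> real" and p l :: real
  assumes p: "p > 1" and l: "l < 1" and L: "\<And>n. L n > 0" and b: "\<And>n. b n \<ge> 0"
  defines "r \<equiv> \<lambda>n. (\<Sum>k\<le>n. L k) / L n"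
  assumes r: "\<And>n. (r n - l) powr (p - 1) * (r (Suc n) - l) \<le> r n powr p"
  shows "(\<Sum>n\<le>N. ((\<Sum>k\<le>n. L k * b k) / (\<Sum>k\<le>n. L k)) powr p) \<le> (1 / (1 - l)) powr p * (\<Sum>n\<le>N. b n powr p)"
proof -
  define S where "S = (\<lambda>n. \<Sum>k\<le>n. L k)"
  have S: "S n > 0" for n
    using L by (auto simp: S_def intro!: sum_pos)
  have S_eq: "S n = r n * L n" for n
    using L[of n] by (simp add: r_def S_def)
  have r_Suc: "r (Suc n) - 1 = S n / L (Suc n)" for n
    using L[of "Suc n"] by (simp add: r_def S_def add_divide_distrib)
  have r_Suc_gt: "r (Suc n) > 1" for n
    using S[of n] L[of "Suc n"] r_Suc[of n] by (smt (verit) divide_pos_pos)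
  have "r 0 = 1"
    using L[of 0] by (simp add: r_def)
  have r_ge: "r n \<ge> 1" for n
    using \<open>r 0 = 1\<close> r_Suc_gt by (cases n) (auto intro: less_imp_le)
  have r_pos: "r n > 0" "r n - l > 0" for n
    using r_ge[of n] l by auto
  \<comment> \<open>Solves the recursion forced by \<open>(1 - l) * W n = (r n - l) * w n\<close>
    and \<open>W (Suc n) - W n = w (Suc n)\<close>, normalised by \<open>W 0 = 1\<close>.\<close>
  define W where "W = (\<lambda>n. \<Prod>k<n. (r (Suc k) - l) / (r (Suc k) - 1))"
  define w where "w = (\<lambda>n. (1 - l) / (r n - l) * W n)"
  have W_pos: "W n > 0" for n
    using r_Suc_gt r_pos by (auto simp: W_def intro!: prod_pos)
  have w_pos: "w n > 0" for n
    using W_pos r_pos l by (simp add: w_def)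
  have W_eq: "(\<Sum>k\<le>n. w k) = W n" for n
  proof (induction n)
    case 0
    show ?case
      using \<open>r 0 = 1\<close> l by (simp add: w_def W_def)
  next
    case (Suc n)
    have "W (Suc n) = W n * ((r (Suc n) - l) / (r (Suc n) - 1))"
      by (simp add: W_def)
    then show ?case
      using Suc r_Suc_gt[of n] r_pos(2)[of "Suc n"] by (simp add: w_def field_simps)
  qed
  \<comment> \<open>\<open>c\<close> collects the Hoelder terms, and \<open>d\<close> is chosen so
    that \<open>c n * d n = b n powr p\<close>.\<close>
  define d where "d = (\<lambda>n. w n powr (p - 1) / L n powr p)"
  define c where "c = (\<lambda>n. (L n * b n) powr p * w n powr (1 - p))"
  have main: "W n powr (p - 1) / S n powr p \<le> (1 / (1 - l)) powr p * (d n - d (Suc n))" for n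
  proof -
    \<comment> \<open>With the common factor \<open>D\<close> removed, the claim becomes the
      hypothesis on \<open>r\<close>, since
      \<open>(1 - l) + (r (Suc n) - 1) = r (Suc n) - l\<close>.\<close>
    define D where "D = w n powr (p - 1) / L n powr p / r n powr p"
    have "D > 0"
      using w_pos[of n] L[of n] r_pos[of n] by (simp add: D_def)
    have pos: "r (Suc n) - 1 > 0" "r n > 0" "r n - l > 0" "L n > 0" "w n > 0" "1 - l > 0"
      using r_Suc_gt[of n] r_pos[of n] L[of n] w_pos[of n] l by auto
    have "W n = (r n - l) / (1 - l) * w n"
      using pos by (simp add: w_def)
    then have W: "W n powr (p - 1) / S n powr p = D * (r n - l) powr (p - 1) / (1 - l) powr (p - 1)"
      using pos by (simp add: D_def S_eq powr_mult powr_divide mult_ac)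
    have "w (Suc n) = (r n - l) / (r (Suc n) - 1) * w n"
      using pos r_pos(2)[of "Suc n"] by (simp add: w_def W_def)
    moreover have "L (Suc n) = L n * r n / (r (Suc n) - 1)"
      using pos L[of "Suc n"] by (simp add: r_Suc S_eq mult.commute)
    ultimately have "d (Suc n) = D * (r n - l) powr (p - 1) * (r (Suc n) - 1)"
      using pos by (simp add: d_def D_def powr_mult powr_divide powr_diff mult_ac)
    moreover have "d n = D * r n powr p"
      using pos by (simp add: d_def D_def)
    ultimately have "d n - d (Suc n) = D * (r n powr p - (r n - l) powr (p - 1) * (r (Suc n) - 1))"
      by (simp add: algebra_simps)
    moreover have "D * ((1 - l) * (r n - l) powr (p - 1)) \<le>
        D * (r n powr p - (r n - l) powr (p - 1) * (r (Suc n) - 1))"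
      using \<open>D > 0\<close> r[of n] by (intro mult_left_mono) (auto simp: algebra_simps)
    ultimately have "(1 / (1 - l)) powr p * (D * ((1 - l) * (r n - l) powr (p - 1)))
        \<le> (1 / (1 - l)) powr p * (d n - d (Suc n))"
      by (intro mult_left_mono) auto
    moreover have "(1 / (1 - l)) powr p * (D * ((1 - l) * (r n - l) powr (p - 1))) =
        W n powr (p - 1) / S n powr p"
      unfolding W using pos by (simp add: powr_divide powr_diff mult_ac)
    ultimately show ?thesis by simp
  qed
  have "((\<Sum>k\<le>n. L k * b k) / S n) powr p \<le> (1 / (1 - l)) powr p * (d n - d (Suc n)) * (\<Sum>k\<le>n. c k)" for n
  proof -
    have "(\<Sum>k\<le>n. L k * b k) powr p \<le> W n powr (p - 1) * (\<Sum>k\<le>n. c k)"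
      using sum_powr_le_weighted[of p "{..n}" "\<lambda>k. L k * b k" w] p w_pos L b
      by (simp add: W_eq c_def less_imp_le)
    then have "(\<Sum>k\<le>n. L k * b k) powr p / S n powr p \<le> W n powr (p - 1) / S n powr p * (\<Sum>k\<le>n. c k)"
      by (simp add: divide_right_mono)
    also have "\<dots> \<le> (1 / (1 - l)) powr p * (d n - d (Suc n)) * (\<Sum>k\<le>n. c k)"
      by (intro mult_right_mono main) (auto simp: c_def intro!: sum_nonneg)
    finally show ?thesis
      using L b S[of n] by (simp add: powr_divide sum_nonneg less_imp_le)
  qed
  then have "(\<Sum>n\<le>N. ((\<Sum>k\<le>n. L k * b k) / S n) powr p) \<le> (1 / (1 - l)) powr p * (\<Sum>n\<le>N. c n * d n)"
    by (intro sum_le_of_telescoping_bound) (auto simp: c_def d_def)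
  also have "(\<lambda>n. c n * d n) = (\<lambda>n. b n powr p)"
  proof
    fix n
    show "c n * d n = b n powr p"
      using L[of n] b[of n] w_pos[of n] by (simp add: c_def d_def powr_mult less_imp_le flip: powr_add)
  qed
  finally show ?thesis
    by (simp add: S_def)
qed

section \<open>Elementary bounds for powers, logarithms and power sums\<close>

text \<open>Maclaurin's theorem in the variable \<open>t\<close> on [0, 1] for
  \<open>(1 + t * z) powr a\<close>, which treats both signs of \<open>z\<close> at once. The factor
  \<open>fact m * (a gchoose m)\<close> in \<open>D\<close> is the falling factorial of the m-th
  derivative.\<close>

lemma Maclaurin_powr:
  fixes a z :: real
  assumes "z > -1" "n > 0"
  shows "\<exists>t. 0 < t \<and> t < 1 \<and> (1 + z) powr a =
    (\<Sum>m<n. (a gchoose m) * z ^ m) + (a gchoose n) * (1 + t * z) powr (a - n) * z ^ n"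
proof -
  define D where "D = (\<lambda>m t. fact m * (a gchoose m) * (1 + t * z) powr (a - real m) * z ^ m)"
  have "DERIV (D m) t :> D (Suc m) t" if "0 \<le> t" "t \<le> 1" for m t
  proof -
    have pos: "1 + t * z > 0"
    proof (cases "z \<ge> 0")
      case False
      then have "t * z \<ge> z"
        using that mult_right_le_one_le[of "-z" t] by (simp add: mult.commute)
      then show ?thesis using assms by linarith
    qed (use that in \<open>simp add: add_pos_nonneg\<close>)
    have fact_gbinomial_Suc: "fact (Suc m) * (a gchoose Suc m) = fact m * (a gchoose m) * (a - real m)"
      by (simp add: gbinomial_absorb_comp gbinomial_Suc_rec gbinomial_prod_rev atLeast0_lessThan_Suc)
    have "((\<lambda>t. (1 + t * z) powr (a - real m)) has_real_derivative
        (a - real m) * (1 + t * z) powr (a - real m - 1) * z) (at t)"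
      by (rule derivative_eq_intros refl | use pos in \<open>simp; fail\<close>)+
    from DERIV_cmult[OF this, of "fact m * (a gchoose m) * z ^ m"]
    have "DERIV (D m) t :> fact m * (a gchoose m) * z ^ m * ((a - real m) * (1 + t * z) powr (a - real m - 1) * z)"
      unfolding D_def by (simp add: mult_ac)
    also have "fact m * (a gchoose m) * z ^ m * ((a - real m) * (1 + t * z) powr (a - real m - 1) * z)
        = fact m * (a gchoose m) * (a - real m) * (1 + t * z) powr (a - real (Suc m)) * z ^ Suc m"
      by (simp add: mult_ac diff_diff_eq add.commute)
    also have "\<dots> = D (Suc m) t"
      unfolding D_def fact_gbinomial_Suc ..
    finally show ?thesis .
  qed
  then have "\<exists>t. 0 < t \<and> t < 1 \<and> D 0 1 = (\<Sum>m<n. D m 0 / fact m * 1 ^ m) + D n t / fact n * 1 ^ n"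
    using assms by (intro Maclaurin) auto
  then show ?thesis
    by (simp add: D_def mult.assoc)
qed

lemma powr_one_plus_le:
  fixes a x :: real
  assumes "0 \<le> a" "a \<le> 1" "x > -1"
  shows "(1 + x) powr a \<le> 1 + a * x"
  using Youngs_inequality_0[of a "1 - a" "1 + x" 1] assms by (simp add: algebra_simps)

lemma ln_one_minus_le:
  fixes x :: real
  assumes "0 \<le> x" "x < 1"
  shows "ln (1 - x) \<le> - x - x\<^sup>2 / 2"
proof -
  have "ln (1 - x) + x + x\<^sup>2 / 2 \<le> ln (1 - 0) + 0 + 0\<^sup>2 / 2"
  proof (rule DERIV_nonpos_imp_nonincreasing[OF assms(1)])
    fix c assume c: "0 \<le> c" "c \<le> x"
    have "((\<lambda>x. ln (1 - x) + x + x\<^sup>2 / 2) has_real_derivative - (c\<^sup>2 / (1 - c))) (at c)"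
      using c assms by (auto intro!: derivative_eq_intros simp: field_simps power2_eq_square)
    moreover have "- (c\<^sup>2 / (1 - c)) \<le> 0"
      using c assms by simp
    ultimately show "\<exists>D. ((\<lambda>x. ln (1 - x) + x + x\<^sup>2 / 2) has_real_derivative D) (at c) \<and> D \<le> 0"
      by blast
  qed
  then show ?thesis by simp
qed

text \<open>All Taylor coefficients in \<open>s\<close> are nonnegative, and so is the Lagrange
  remainder of order 4.\<close>

lemma powr_one_minus_ge:
  fixes q s :: real
  assumes "q \<ge> 0" "0 \<le> s" "s < 1"
  shows "1 + q * s + q * (q + 1) / 2 * s\<^sup>2 + q * (q + 1) * (q + 2) / 6 * s ^ 3 \<le> (1 - s) powr (- q)"
proof -
  obtain t where t: "0 < t" "t < 1" and eq: "(1 + (-s)) powr (-q) =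
    (\<Sum>m<4. (-q gchoose m) * (-s) ^ m) + (-q gchoose 4) * (1 + t * (-s)) powr (-q - 4) * (-s) ^ 4"
    using Maclaurin_powr[of "-s" 4 "-q"] assms by auto
  have "(-q gchoose 4) = q * (q + 1) * (q + 2) * (q + 3) / 24"
    by (simp add: gbinomial_prod_rev eval_nat_numeral field_simps)
  then have "(-q gchoose 4) \<ge> 0"
    using assms by (simp only:) simp
  then have "(-q gchoose 4) * (1 + t * (-s)) powr (-q - 4) * (-s) ^ 4 \<ge> 0"
    using assms by simp
  moreover have "(\<Sum>m<4. (-q gchoose m) * (-s) ^ m) =
     1 + q * s + q * (q + 1) / 2 * s\<^sup>2 + q * (q + 1) * (q + 2) / 6 * s ^ 3"
    by (simp add: gbinomial_prod_rev eval_nat_numeral field_simps)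
  ultimately show ?thesis
    using eq by simp
qed

text \<open>The remainder of order 5 is nonnegative. The cubic and quartic terms are merged using
  \<open>x \<le> 1\<close>; the constant 1/12 comes from
  \<open>(2 - a) * (1 + a) = 2 + a * (1 - a) \<ge> 2\<close>.\<close>

lemma powr_one_plus_ge:
  fixes a x :: real
  assumes "0 \<le> a" "a \<le> 1" "0 \<le> x" "x \<le> 1"
  shows "1 + a * x - a * (1 - a) * (1 / 2 - x / 12) * x\<^sup>2 \<le> (1 + x) powr a"
proof -
  obtain t where t: "0 < t" "t < 1" and eq: "(1 + x) powr a =
    (\<Sum>m<5. (a gchoose m) * x ^ m) + (a gchoose 5) * (1 + t * x) powr (a - 5) * x ^ 5"
    using Maclaurin_powr[of x 5 a] assms by auto
  have "(a gchoose 5) = a * (1 - a) * (2 - a) * (3 - a) * (4 - a) / 120"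
    by (simp add: gbinomial_prod_rev eval_nat_numeral field_simps)
  then have "(a gchoose 5) \<ge> 0"
    using assms by (simp only:) simp
  then have "(a gchoose 5) * (1 + t * x) powr (a - 5) * x ^ 5 \<ge> 0"
    using assms by simp
  moreover have "(\<Sum>m<5. (a gchoose m) * x ^ m) =
     1 + a * x - a * (1 - a) * (1 / 2 - (2 - a) * x / 6 * (1 - (3 - a) * x / 4)) * x\<^sup>2"
    by (simp add: gbinomial_prod_rev eval_nat_numeral field_simps)
  moreover have "x / 12 \<le> (2 - a) * x / 6 * (1 - (3 - a) * x / 4)"
  proof -
    have "(3 - a) * x \<le> (3 - a) * 1"
      using assms by (intro mult_left_mono) auto
    then have "(1 + a) / 4 \<le> 1 - (3 - a) * x / 4" by simp
    then have "(2 - a) * x / 6 * ((1 + a) / 4) \<le> (2 - a) * x / 6 * (1 - (3 - a) * x / 4)"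
      using assms by (intro mult_left_mono) auto
    moreover have "(2 - a) * x / 6 * ((1 + a) / 4) = x / 12 + x * (a * (1 - a)) / 24"
      by (simp add: field_simps)
    ultimately show ?thesis
      using assms by (smt (verit) divide_nonneg_pos mult_nonneg_nonneg)
  qed
  then have "a * (1 - a) * (1 / 2 - (2 - a) * x / 6 * (1 - (3 - a) * x / 4)) * x\<^sup>2
      \<le> a * (1 - a) * (1 / 2 - x / 12) * x\<^sup>2"
    using assms by (intro mult_right_mono mult_left_mono) auto
  ultimately show ?thesis
    using eq by linarith
qed

text \<open>Rests on \<open>ln (1 + x) \<ge> x * ln 2\<close>, obtained from Bernoulli's inequality
  for \<open>(1 + 1) powr x\<close>. The factor 2/3 is the least c with
  \<open>\<theta> - \<theta> ^ 3 \<le> c * (1 - \<theta> ^ 3)\<close> on [0, 1], which is what the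
  interpolation in \<open>cubic_estimate\<close> requires.\<close>

lemma powr_one_plus_ge_linear:
  fixes a x :: real
  assumes "0 \<le> a" "0 \<le> x" "x \<le> 1"
  shows "1 + 2 / 3 * (a * x) \<le> (1 + x) powr a"
proof -
  have "exp (2 / 3 * x) \<le> exp (x * ln 2)"
    using ln2_ge_two_thirds assms mult_left_mono[of "2/3" "ln 2" x] by (simp add: mult.commute)
  also have "\<dots> = (1 + 1) powr x"
    by (simp add: powr_def)
  also have "\<dots> \<le> 1 + x"
    using powr_one_plus_le[of x 1] assms by simp
  finally have "2 / 3 * x \<le> ln (1 + x)"
    using assms by (subst ln_ge_iff) auto
  then have "a * (2 / 3 * x) \<le> a * ln (1 + x)"
    using assms by (intro mult_left_mono) auto
  also have "1 + a * ln (1 + x) \<le> (1 + x) powr a"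
    using assms exp_ge_add_one_self[of "a * ln (1 + x)"] by (simp add: powr_def)
  finally show ?thesis by simp
qed

text \<open>The Levin--Stechkin inequality.\<close>

lemma sum_powr_ge:
  fixes \<alpha> :: real
  assumes "0 \<le> \<alpha>" "\<alpha> \<le> 1"
  shows "n * (n + 1) powr \<alpha> \<le> (\<alpha> + 1) * (\<Sum>k<n. real (Suc k) powr \<alpha>)"
proof (induction n)
  case (Suc n)
  have "(1 + 1 / (real n + 1)) powr \<alpha> \<le> 1 + \<alpha> * (1 / (real n + 1))"
    using assms by (intro powr_one_plus_le) (auto intro: less_le_trans[of _ 0])
  then have "(n + 1) powr (\<alpha>::real) * (1 + 1 / (real n + 1)) powr \<alpha>
      \<le> (n + 1) powr \<alpha> * (1 + \<alpha> * (1 / (real n + 1)))"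
    by (intro mult_left_mono) auto
  also have "(n + 1) powr (\<alpha>::real) * (1 + 1 / (real n + 1)) powr \<alpha> = (n + 2) powr \<alpha>"
  proof -
    have "(n + 1) * (1 + 1 / (real n + 1)) = real (n + 2)"
      by (simp add: field_simps)
    then show ?thesis
      by (metis powr_mult)
  qed
  finally have "(real n + 1) * (n + 2) powr \<alpha> \<le> (real n + 1) * ((n + 1) powr \<alpha> * (1 + \<alpha> * (1 / (real n + 1))))"
    by (intro mult_left_mono) auto
  also have "\<dots> = n * (n + 1) powr \<alpha> + (\<alpha> + 1) * (n + 1) powr \<alpha>"
    by (simp add: field_simps)
  finally show ?case
    using Suc.IH by (simp add: algebra_simps)
qed auto

section \<open>The estimate for exponents from 1.35 on\<close>

text \<open>
  The constants \<open>7/54\<close> and \<open>3/40\<close> here and below come from the Taylor coefficients \<open>(1 - u)/2\<close> and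
  \<open>(1 - u\<^sup>2)/6\<close> of \<open>(1 - u y) powr (1 - 1/u)\<close> at the threshold \<open>u = 1/1.35 = 20/27\<close>.
\<close>

lemma polynomial_estimate:
  fixes a x :: real
  assumes "0 \<le> a" "a \<le> 1" "0 \<le> x" "x \<le> 1"
  shows "a * (1 - a) * (1 / 2 - x / 12) * (1 + a * x)\<^sup>2 \<le> 7 / 54 * (1 + a * x) + 3 / 40 * x"
proof -
  \<comment> \<open>The coefficients of right side minus left side as a cubic in \<open>x\<close>.
    As \<open>c2\<close> can be negative, it is paired with \<open>c1\<close> through
    \<open>x = x * (1 - x) + x\<^sup>2\<close>.\<close>
  define c0 where "c0 = 7 / 54 - a * (1 - a) / 2"
  define c1 where "c1 = 3 / 40 + 7 / 54 * a - a * (1 - a) * (a - 1 / 12)"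
  define c2 where "c2 = - (a * (1 - a) * (a\<^sup>2 / 2 - a / 6))"
  define c3 where "c3 = a ^ 3 * (1 - a) / 12"
  \<comment> \<open>These two bounds reduce \<open>c1\<close> and \<open>c1 + c2\<close> to
    quadratics in \<open>a\<close>, whose minima lie at 25/54 and 25/42.\<close>
  have cube: "a ^ 3 \<ge> 4 / 3 * a\<^sup>2 - 4 / 9 * a"
    using mult_nonneg_nonneg[OF assms(1) zero_le_power2[of "a - 2 / 3"]]
    by (simp add: power2_eq_square power3_eq_cube algebra_simps)
  have fourth: "a ^ 4 \<ge> 4 / 3 * a ^ 3 - 4 / 9 * a\<^sup>2"
    using mult_nonneg_nonneg[OF zero_le_power2[of a] zero_le_power2[of "a - 2 / 3"]]
    by (simp add: power2_eq_square power3_eq_cube eval_nat_numeral algebra_simps)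
  have "c0 \<ge> 0"
    using zero_le_power2[of "a - 1 / 2"] by (simp add: c0_def power2_eq_square algebra_simps)
  moreover have "c1 \<ge> 0"
  proof -
    have "c1 = 3 / 40 + 23 / 108 * a - 13 / 12 * a\<^sup>2 + a ^ 3"
      unfolding c1_def by algebra
    then show ?thesis
      using cube zero_le_power2[of "a - 25 / 54"] by (simp add: power2_eq_square algebra_simps)
  qed
  moreover have "c1 + c2 \<ge> 0"
  proof -
    have "c1 + c2 = 3 / 40 + 23 / 108 * a - 11 / 12 * a\<^sup>2 + a ^ 3 / 3 + a ^ 4 / 2"
      by (simp add: c1_def c2_def eval_nat_numeral field_simps)
    then show ?thesis
      using cube fourth zero_le_power2[of "a - 25 / 42"] by (simp add: power2_eq_square algebra_simps)
  qed
  moreover have "c3 \<ge> 0"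
    using assms by (simp add: c3_def)
  ultimately have "x * (1 - x) * c1 \<ge> 0" "x\<^sup>2 * (c1 + c2) \<ge> 0" "x ^ 3 * c3 \<ge> 0"
    using assms by (intro mult_nonneg_nonneg; simp)+
  with \<open>c0 \<ge> 0\<close> have "0 \<le> c0 + x * (1 - x) * c1 + x\<^sup>2 * (c1 + c2) + x ^ 3 * c3"
    by linarith
  also have "c0 + x * (1 - x) * c1 + x\<^sup>2 * (c1 + c2) + x ^ 3 * c3 =
      7 / 54 * (1 + a * x) + 3 / 40 * x - a * (1 - a) * (1 / 2 - x / 12) * (1 + a * x)\<^sup>2"
    by (simp add: c0_def c1_def c2_def c3_def eval_nat_numeral field_simps)
  finally show ?thesis by simp
qed

text \<open>The extreme case \<open>y = x * t\<close> of \<open>cubic_estimate\<close>. Division by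
  \<open>t\<close> turns it into a lower bound for \<open>(1 + x) powr a\<close>; Bernoulli's
  inequality \<open>1 / (1 + a * x) \<le> t\<close> then leads to the polynomial estimate.\<close>

lemma cubic_estimate_endpoint:
  fixes a x :: real
  assumes a: "0 \<le> a" "a \<le> 1" and x: "0 < x" "x \<le> 1"
  defines "t \<equiv> (1 + x) powr (- a)"
  shows "a * (x * t) - 7 / 54 * (x * t)\<^sup>2 - 3 / 40 * (x * t) ^ 3 \<le> 1 - t"
proof -
  define z where "z = 1 / (1 + a * x)"
  have pos: "1 + a * x > 0"
    using a x by (intro add_pos_nonneg) auto
  have z: "z > 0" "z * (1 + a * x) = 1"
    using pos by (auto simp: z_def)
  have t: "t > 0" "t * (1 + x) powr a = 1"
    using x by (auto simp: t_def powr_minus)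
  have "z \<le> t"
    using powr_one_plus_le[of a x] a x pos unfolding z_def t_def
    by (auto simp: powr_minus divide_simps)
  have "a * (1 - a) * (1 / 2 - x / 12) = a * (1 - a) * (1 / 2 - x / 12) * (1 + a * x)\<^sup>2 * z\<^sup>2"
    using z by (simp add: mult.assoc flip: power_mult_distrib) (simp add: mult.commute)
  also have "\<dots> \<le> (7 / 54 * (1 + a * x) + 3 / 40 * x) * z\<^sup>2"
    using a x by (intro mult_right_mono polynomial_estimate) auto
  also have "\<dots> = 7 / 54 * z + 3 / 40 * x * z\<^sup>2"
    using z by algebra
  also have "\<dots> \<le> 7 / 54 * t + 3 / 40 * x * t\<^sup>2"
    using \<open>z \<le> t\<close> z x by (intro add_mono mult_left_mono power_mono) auto
  finally have "a * (1 - a) * (1 / 2 - x / 12) * x\<^sup>2 \<le> (7 / 54 * t + 3 / 40 * x * t\<^sup>2) * x\<^sup>2"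
    by (rule mult_right_mono) simp
  with powr_one_plus_ge[of a x] a x
  have "1 + a * x - (7 / 54 * t + 3 / 40 * x * t\<^sup>2) * x\<^sup>2 \<le> (1 + x) powr a"
    by linarith
  from mult_left_mono[OF this, of t] t
  have "t * (1 + a * x - (7 / 54 * t + 3 / 40 * x * t\<^sup>2) * x\<^sup>2) \<le> 1"
    by simp
  then show ?thesis
    by (simp add: power2_eq_square power3_eq_cube algebra_simps)
qed

text \<open>With \<open>y = \<theta> * (x * t)\<close>, the claim follows from a convex combination
  of the endpoint inequality and the coarse bound \<open>2 / 3 * A \<le> 1 - t\<close>.\<close>

lemma cubic_estimate:
  fixes a x y :: real
  assumes a: "0 \<le> a" "a \<le> 1" and x: "0 < x" "x \<le> 1"
  defines "t \<equiv> (1 + x) powr (- a)"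
  assumes y: "0 \<le> y" "y \<le> x * t"
  shows "t + a * y \<le> 1 + 7 / 54 * y\<^sup>2 + 3 / 40 * y ^ 3"
proof -
  have t: "t > 0" "t * (1 + x) powr a = 1"
    using x by (auto simp: t_def powr_minus)
  define \<theta> where "\<theta> = y / (x * t)"
  have \<theta>: "0 \<le> \<theta>" "\<theta> \<le> 1" "y = \<theta> * (x * t)"
    using y x t by (auto simp: \<theta>_def)
  define A B C where "A = a * (x * t)" and "B = 7 / 54 * (x * t)\<^sup>2" and "C = 3 / 40 * (x * t) ^ 3"
  have "A \<ge> 0" "B \<ge> 0"
    using a x t by (auto simp: A_def B_def)
  have 1: "A - B - C \<le> 1 - t"
    using cubic_estimate_endpoint[of a x] a x by (simp add: A_def B_def C_def t_def)
  have "t * (1 + 2 / 3 * (a * x)) \<le> t * (1 + x) powr a"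
    using a x t by (intro mult_left_mono powr_one_plus_ge_linear) auto
  then have 2: "2 / 3 * A \<le> 1 - t"
    using t by (simp add: A_def algebra_simps)
  have "\<theta> ^ 3 \<le> 1"
    using \<theta> by (intro power_le_one) auto
  \<comment> \<open>The weights \<open>\<theta>\<^sup>3\<close> and \<open>1 - \<theta>\<^sup>3\<close> match the cubic term exactly and leave nonnegative defects.\<close>
  have "\<theta> * A - \<theta>\<^sup>2 * B - \<theta> ^ 3 * C = \<theta> ^ 3 * (A - B - C) + (1 - \<theta> ^ 3) * (2 / 3 * A)
      - (1 - \<theta>)\<^sup>2 * (2 + \<theta>) / 3 * A - \<theta>\<^sup>2 * (1 - \<theta>) * B"
    by algebra
  also have "\<dots> \<le> \<theta> ^ 3 * (A - B - C) + (1 - \<theta> ^ 3) * (2 / 3 * A)"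
  proof -
    have "(1 - \<theta>)\<^sup>2 * (2 + \<theta>) / 3 * A \<ge> 0" "\<theta>\<^sup>2 * (1 - \<theta>) * B \<ge> 0"
      using \<theta> \<open>A \<ge> 0\<close> \<open>B \<ge> 0\<close> by (auto intro!: mult_nonneg_nonneg)
    then show ?thesis by linarith
  qed
  also have "\<dots> \<le> \<theta> ^ 3 * (1 - t) + (1 - \<theta> ^ 3) * (1 - t)"
    using 1 2 \<theta> \<open>\<theta> ^ 3 \<le> 1\<close> by (intro add_mono mult_left_mono) auto
  also have "\<dots> = 1 - t"
    by (simp add: algebra_simps)
  finally show ?thesis
    by (simp add: \<theta>(3) A_def B_def C_def power_mult_distrib mult_ac)
qed

text \<open>The linear Taylor term \<open>(1 - 1 / p) * y\<close> of the right side cancels against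
  the left, which leaves \<open>t + a * y\<close> for \<open>cubic_estimate\<close>.\<close>

lemma powr_estimate_large_exponent:
  fixes a x y p :: real
  assumes a: "0 \<le> a" "a \<le> 1" and x: "0 < x" "x \<le> 1" and p: "p \<ge> 1.35"
  defines "t \<equiv> (1 + x) powr (- a)"
  assumes y: "0 \<le> y" "y \<le> x * t" "y \<le> 1"
  shows "t + (1 + a - 1 / p) * y \<le> (1 - y / p) powr (1 - p)"
proof -
  define u where "u = 1 / p"
  have u: "0 < u" "u \<le> 20 / 27" "p * u = 1"
    using p by (auto simp: u_def field_simps)
  have "y / p < 1"
    using p y by simp
  then have "1 + (p - 1) * (y / p) + (p - 1) * (p - 1 + 1) / 2 * (y / p)\<^sup>2
      + (p - 1) * (p - 1 + 1) * (p - 1 + 2) / 6 * (y / p) ^ 3 \<le> (1 - y / p) powr (- (p - 1))"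
    using p y by (intro powr_one_minus_ge) auto
  also have "y / p = u * y"
    by (simp add: u_def)
  also have "1 + (p - 1) * (u * y) + (p - 1) * (p - 1 + 1) / 2 * (u * y)\<^sup>2
      + (p - 1) * (p - 1 + 1) * (p - 1 + 2) / 6 * (u * y) ^ 3
      = 1 + (1 - u) * y + (1 - u) / 2 * y\<^sup>2 + (1 - u\<^sup>2) / 6 * y ^ 3"
    using u(3) by algebra
  finally have lower: "1 + (1 - u) * y + (1 - u) / 2 * y\<^sup>2 + (1 - u\<^sup>2) / 6 * y ^ 3 \<le> (1 - u * y) powr (1 - p)"
    by simp
  have "u\<^sup>2 \<le> (20 / 27)\<^sup>2"
    using u by (intro power_mono) auto
  then have "7 / 54 \<le> (1 - u) / 2" "3 / 40 \<le> (1 - u\<^sup>2) / 6"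
    using u by (auto simp: power2_eq_square)
  then have "7 / 54 * y\<^sup>2 \<le> (1 - u) / 2 * y\<^sup>2" "3 / 40 * y ^ 3 \<le> (1 - u\<^sup>2) / 6 * y ^ 3"
    using y by (intro mult_right_mono; simp)+
  moreover have "t + a * y \<le> 1 + 7 / 54 * y\<^sup>2 + 3 / 40 * y ^ 3"
    using cubic_estimate[of a x y] a x y unfolding t_def by simp
  ultimately have "t + a * y + (1 - u) * y \<le> (1 - u * y) powr (1 - p)"
    using lower by linarith
  then show ?thesis
    by (simp add: u_def algebra_simps)
qed

section \<open>The estimate for exponents below 1.35\<close>

text \<open>If \<open>y = s * w\<close> with \<open>w = (1 + s) powr (- a)\<close>, Bernoulli gives
  \<open>1 - a * y \<le> w\<close>. Raising this to the nonpositive power \<open>1 - 1 / a\<close>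
  reverses it, and \<open>w powr (1 - 1 / a) = (1 + s) powr (1 - a) = w + y\<close>.\<close>

lemma powr_estimate_conjugate:
  fixes a x y :: real
  assumes a: "0 < a" "a \<le> 1" and x: "0 < x"
  defines "t \<equiv> (1 + x) powr (- a)"
  assumes y: "0 \<le> y" "y \<le> x * t" "y < 1"
  shows "t + y \<le> (1 - a * y) powr (1 - 1 / a)"
proof -
  \<comment> \<open>\<open>y\<close> may be smaller than \<open>x * t\<close>; a smaller point
    \<open>s\<close> restores equality, and passing from \<open>x\<close> to \<open>s\<close> only
    increases \<open>t\<close> to \<open>w\<close>.\<close>
  have "\<exists>s. 0 \<le> s \<and> s \<le> x \<and> s * (1 + s) powr (- a) = y"
    using x y unfolding t_def by (intro IVT') (auto intro!: continuous_intros)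
  then obtain s where s: "0 \<le> s" "s \<le> x" "s * (1 + s) powr (- a) = y"
    by blast
  define w where "w = (1 + s) powr (- a)"
  have w: "w > 0" "w * (1 + s) powr a = 1"
    using s by (auto simp: w_def powr_minus)
  have "w * (1 + s) powr a \<le> w * (1 + a * s)"
    using a s w by (intro mult_left_mono powr_one_plus_le) auto
  then have "1 - a * y \<le> w"
    using w s by (simp add: w_def algebra_simps)
  moreover have "1 - a * y > 0"
    using mult_left_le_one_le[of y a] a y by linarith
  ultimately have "w powr (1 - 1 / a) \<le> (1 - a * y) powr (1 - 1 / a)"
    using a by (intro powr_mono2') (auto simp: field_simps)
  moreover have "w powr (1 - 1 / a) = (1 + s) powr (1 - a)"
    using a by (simp add: w_def powr_powr algebra_simps)
  moreover have "(1 + s) powr (1 - a) = w + y"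
    using s by (simp add: w_def powr_diff powr_minus field_simps)
  moreover have "t \<le> w"
    using s a unfolding t_def w_def by (intro powr_mono2') auto
  ultimately show ?thesis by linarith
qed

text \<open>The derivative in the parameter is \<open>E * Q + y\<close>, where \<open>Q\<close> is
  the logarithmic derivative of the power \<open>E\<close>; it is nonpositive because
  \<open>E \<ge> 1\<close> and \<open>Q \<le> - y\<close>.\<close>

lemma powr_estimate_mono:
  fixes u v y :: real
  assumes u: "20 / 27 \<le> u" "u \<le> v" "v \<le> 1" and y: "0 \<le> y" "y \<le> 3 / 5"
  shows "(1 - v * y) powr (1 - 1 / v) + v * y \<le> (1 - u * y) powr (1 - 1 / u) + u * y"
proof (rule DERIV_nonpos_imp_nonincreasing[OF u(2)])
  fix c assume c: "u \<le> c" "c \<le> v"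
  define E where "E = (1 - c * y) powr (1 - 1 / c)"
  define Q where "Q = ln (1 - c * y) / c\<^sup>2 + (1 - 1 / c) * (- y) / (1 - c * y)"
  have c_bounds: "20 / 27 \<le> c" "c \<le> 1"
    using c u by auto
  then have "c * y \<le> 1 * (3 / 5)"
    using y by (intro mult_mono) auto
  then have cy: "0 \<le> c * y" "c * y < 1"
    using y c_bounds by auto
  have "E \<ge> 1"
  proof -
    have "(1 - c * y) powr 0 \<le> (1 - c * y) powr (1 - 1 / c)"
      using cy c_bounds by (intro powr_mono') (auto simp: field_simps)
    then show ?thesis
      using cy by (simp add: E_def)
  qed
  have "Q \<le> - y"
  proof -
    have "ln (1 - c * y) \<le> - (c * y) - (c * y)\<^sup>2 / 2"
      using cy by (intro ln_one_minus_le) auto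
    then have "ln (1 - c * y) / c\<^sup>2 \<le> (- (c * y) - (c * y)\<^sup>2 / 2) / c\<^sup>2"
      by (rule divide_right_mono) simp
    also have "\<dots> = - y / c - y\<^sup>2 / 2"
      using c_bounds by (simp add: field_simps power2_eq_square)
    finally have 1: "ln (1 - c * y) / c\<^sup>2 \<le> - y / c - y\<^sup>2 / 2" .
    \<comment> \<open>Equivalent to \<open>c \<ge> 5 / 7\<close>, which
      \<open>c \<ge> 20 / 27\<close> ensures. It lets the quadratic term of the logarithm absorb the
      remaining \<open>y\<^sup>2\<close> term.\<close>
    have "2 * (1 - c) \<le> 1 - c * (3 / 5)"
      using c_bounds by simp
    also have "\<dots> \<le> 1 - c * y"
      using y c_bounds by (intro diff_left_mono mult_left_mono) auto
    finally have "2 * (1 - c) \<le> 1 - c * y" .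
    then have "(1 - c) / (1 - c * y) \<le> 1 / 2"
      using cy by (simp add: divide_simps)
    then have 2: "y\<^sup>2 * ((1 - c) / (1 - c * y)) \<le> y\<^sup>2 * (1 / 2)"
      by (intro mult_left_mono) auto
    have "(1 - 1 / c) * (- y) / (1 - c * y) = y / c - y + y\<^sup>2 * ((1 - c) / (1 - c * y))"
      using cy c_bounds by (simp add: divide_simps) algebra
    with 1 2 show ?thesis
      unfolding Q_def by linarith
  qed
  have "E * Q \<le> 1 * Q"
    using \<open>E \<ge> 1\<close> \<open>Q \<le> - y\<close> y by (intro mult_right_mono_neg) auto
  then have "E * Q + y \<le> 0"
    using \<open>Q \<le> - y\<close> by simp
  moreover have "((\<lambda>c. (1 - c * y) powr (1 - 1 / c) + c * y) has_real_derivative E * Q + y) (at c)"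
  proof -
    have "((\<lambda>c. 1 - c * y) has_real_derivative - y) (at c)"
      by (auto intro!: derivative_eq_intros)
    moreover have "((\<lambda>c. 1 - 1 / c) has_real_derivative 1 / c\<^sup>2) (at c)"
      using c_bounds by (auto intro!: derivative_eq_intros simp: power2_eq_square)
    ultimately have "((\<lambda>c. (1 - c * y) powr (1 - 1 / c)) has_real_derivative
        E * (1 / c\<^sup>2 * ln (1 - c * y) + - y * (1 - 1 / c) / (1 - c * y))) (at c)"
      unfolding E_def using cy by (intro DERIV_powr) auto
    also have "1 / c\<^sup>2 * ln (1 - c * y) + - y * (1 - 1 / c) / (1 - c * y) = Q"
      by (simp add: Q_def)
    finally show ?thesis
      by (intro DERIV_add) (auto intro!: derivative_eq_intros)
  qed
  ultimately show "\<exists>D. ((\<lambda>c. (1 - c * y) powr (1 - 1 / c) + c * y) has_real_derivative D) (at c) \<and> D \<le> 0"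
    by blast
qed

lemma powr_estimate_small_exponent:
  fixes a x y p :: real
  assumes a: "0 \<le> a" "a \<le> 1" and x: "0 < x" and p: "1 < p" "p \<le> 1.35" "1 / p \<le> a"
  defines "t \<equiv> (1 + x) powr (- a)"
  assumes y: "0 \<le> y" "y \<le> x * t" "y \<le> 3 / 5"
  shows "t + (1 + a - 1 / p) * y \<le> (1 - y / p) powr (1 - p)"
proof -
  have "20 / 27 \<le> 1 / p"
    using p by (simp add: field_simps)
  moreover from this have "t + y \<le> (1 - a * y) powr (1 - 1 / a)"
    using powr_estimate_conjugate[of a x y] a x p y unfolding t_def by linarith
  ultimately show ?thesis
    using powr_estimate_mono[of "1 / p" a y] a p y by (simp add: algebra_simps)
qed

section \<open>The ratio condition for power weights and the final inequality\<close>

text \<open>Supplies the hypothesis of \<open>weighted_mean_sum_le\<close>. Index \<open>n\<close>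
  stands for the weight at \<open>Suc n\<close>, hence \<open>x = 1 / real (Suc n)\<close>. Dividing
  by powers of \<open>r n\<close> leaves an inequality in \<open>t\<close> and \<open>y\<close>, as
  \<open>r (Suc n) = 1 + r n * t\<close> and \<open>l = r n * (y / p)\<close>.\<close>

lemma sum_powr_estimate:
  fixes \<alpha> p :: real
  assumes "(p \<ge> 1.35 \<and> 0 \<le> \<alpha> \<and> \<alpha> \<le> 1) \<or> (p > 1 \<and> 1 / p \<le> \<alpha> \<and> \<alpha> \<le> 1)"
  defines "r \<equiv> \<lambda>n. (\<Sum>k\<le>n. real (Suc k) powr \<alpha>) / real (Suc n) powr \<alpha>"
    and "l \<equiv> 1 / ((\<alpha> + 1) * p)"
  shows "(r n - l) powr (p - 1) * (r (Suc n) - l) \<le> r n powr p"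
proof -
  have p: "p > 1"
    using assms(1) by auto
  then have "1 / p > 0" by simp
  then have \<alpha>: "0 \<le> \<alpha>" "\<alpha> \<le> 1"
    using assms(1) by linarith+
  define x where "x = 1 / real (Suc n)"
  define t where "t = (1 + x) powr (- \<alpha>)"
  define y where "y = 1 / ((\<alpha> + 1) * r n)"
  have x: "0 < x" "x \<le> 1"
    by (auto simp: x_def)
  have n_pow: "real (Suc n) powr \<alpha> > 0" by simp
  have one_plus_x: "(1 + x) powr \<alpha> = real (Suc (Suc n)) powr \<alpha> / real (Suc n) powr \<alpha>"
    by (simp add: x_def field_simps flip: powr_divide)
  then have t: "t * real (Suc (Suc n)) powr \<alpha> = real (Suc n) powr \<alpha>" "t > 0"
    using x by (auto simp: t_def powr_minus)
  have "r n \<ge> 1"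
    by (simp add: r_def sum_nonneg flip: lessThan_Suc_atMost)
  have y: "0 < y" "y * ((\<alpha> + 1) * r n) = 1"
    using \<open>r n \<ge> 1\<close> \<alpha> by (auto simp: y_def)
  have "real (Suc n) * real (Suc (Suc n)) powr \<alpha> \<le> (\<alpha> + 1) * (r n * real (Suc n) powr \<alpha>)"
    using sum_powr_ge[OF \<alpha>, of "Suc n"] by (simp add: r_def lessThan_Suc_atMost add_ac)
  moreover have "real (Suc (Suc n)) powr \<alpha> = real (Suc n) powr \<alpha> / t"
    using t by (simp add: field_simps del: of_nat_Suc)
  ultimately have "real (Suc n) / t * real (Suc n) powr \<alpha> \<le> (\<alpha> + 1) * r n * real (Suc n) powr \<alpha>"
    by (simp add: mult_ac del: of_nat_Suc)
  then have "real (Suc n) / t \<le> (\<alpha> + 1) * r n"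
    using n_pow by (rule mult_right_le_imp_le)
  then have "1 / (x * t) \<le> (\<alpha> + 1) * r n"
    by (simp add: x_def)
  then have "y \<le> x * t"
    unfolding y_def using le_imp_inverse_le[of "1 / (x * t)" "(\<alpha> + 1) * r n"] x t(2)
    by (simp add: inverse_eq_divide)
  have "y \<le> 1 / (\<alpha> + 1)"
    unfolding y_def using \<open>r n \<ge> 1\<close> \<alpha> by (intro divide_left_mono) auto
  have key: "t + (1 + \<alpha> - 1 / p) * y \<le> (1 - y / p) powr (1 - p)"
  proof (cases "p \<ge> 1.35")
    case True
    have "1 / (\<alpha> + 1) \<le> 1"
      using \<alpha> by simp
    then have "y \<le> 1"
      using \<open>y \<le> 1 / (\<alpha> + 1)\<close> by linarith
    then show ?thesis
      unfolding t_def using True \<alpha> x y \<open>y \<le> x * t\<close>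
      by (intro powr_estimate_large_exponent) (auto simp: t_def)
  next
    case False
    then have "1 / p \<le> \<alpha>"
      using assms(1) by auto
    moreover have "20 / 27 < 1 / p"
      using False p by (simp add: field_simps)
    \<comment> \<open>\<open>\<alpha> > 20 / 27\<close> gives a bound of 27/47, below the 3/5 needed
      for monotonicity in the parameter.\<close>
    ultimately have "1 / (\<alpha> + 1) \<le> 3 / 5"
      by (simp add: field_simps)
    then show ?thesis
      unfolding t_def using False \<alpha> x y p \<open>y \<le> x * t\<close> \<open>1 / p \<le> \<alpha>\<close> \<open>y \<le> 1 / (\<alpha> + 1)\<close>
      by (intro powr_estimate_small_exponent) (auto simp: t_def)
  qed
  have l: "l = r n * (y / p)"
    using y p \<alpha> \<open>r n \<ge> 1\<close> by (simp add: l_def y_def)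
  have "y < p"
    using \<open>y \<le> 1 / (\<alpha> + 1)\<close> \<alpha> p by (smt (verit) divide_le_eq_1)
  then have s: "1 - y / p > 0"
    using p by simp
  have "r (Suc n) = 1 + r n * t"
  proof -
    have "r (Suc n) = (r n * real (Suc n) powr \<alpha> + real (Suc (Suc n)) powr \<alpha>) / real (Suc (Suc n)) powr \<alpha>"
      by (simp add: r_def)
    also have "\<dots> = 1 + r n * t"
      by (simp add: add_divide_distrib del: of_nat_Suc flip: t(1))
    finally show ?thesis .
  qed
  then have "r (Suc n) - l = r n * (t + (1 + \<alpha> - 1 / p) * y)"
    using y(2) l by (simp add: algebra_simps)
  also have "\<dots> \<le> r n * (1 - y / p) powr (1 - p)"
    using key \<open>r n \<ge> 1\<close> by (intro mult_left_mono) auto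
  finally have "(r n - l) powr (p - 1) * (r (Suc n) - l)
      \<le> (r n - l) powr (p - 1) * (r n * (1 - y / p) powr (1 - p))"
    by (rule mult_left_mono) simp
  also have "\<dots> = (r n * (1 - y / p)) powr (p - 1) * (r n * (1 - y / p) powr (1 - p))"
    using l by (simp add: algebra_simps)
  also have "\<dots> = (r n powr (p - 1) * r n) * ((1 - y / p) powr (p - 1) * (1 - y / p) powr (1 - p))"
    using s \<open>r n \<ge> 1\<close> by (simp add: powr_mult)
  also have "(1 - y / p) powr (p - 1) * (1 - y / p) powr (1 - p) = 1"
    using \<open>y < p\<close> by (simp flip: powr_add)
  also have "r n powr (p - 1) * r n = r n powr p"
    using \<open>r n \<ge> 1\<close> by (simp add: powr_diff)
  finally show ?thesis by simp
qed

lemma cmod_weighted_mean_le: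
  "cmod (weighted_mean \<alpha> a (Suc n)) \<le>
    (\<Sum>k\<le>n. real (Suc k) powr \<alpha> * cmod (a (Suc k))) / (\<Sum>k\<le>n. real (Suc k) powr \<alpha>)"
proof -
  have "weighted_mean \<alpha> a (Suc n) =
    (\<Sum>k\<le>n. of_real (real (Suc k) powr \<alpha>) * a (Suc k)) / of_real (\<Sum>k\<le>n. real (Suc k) powr \<alpha>)"
    by (simp only: weighted_mean_def One_nat_def sum.atLeast1_atMost_eq lessThan_Suc_atMost) simp
  then have "cmod (weighted_mean \<alpha> a (Suc n)) =
    cmod (\<Sum>k\<le>n. of_real (real (Suc k) powr \<alpha>) * a (Suc k)) / (\<Sum>k\<le>n. real (Suc k) powr \<alpha>)"
    by (simp add: norm_divide sum_nonneg del: of_real_sum of_nat_Suc)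
  also have "\<dots> \<le> (\<Sum>k\<le>n. cmod (of_real (real (Suc k) powr \<alpha>) * a (Suc k))) / (\<Sum>k\<le>n. real (Suc k) powr \<alpha>)"
    by (intro divide_right_mono norm_sum sum_nonneg) auto
  finally show ?thesis
    by (simp add: norm_mult del: of_nat_Suc)
qed

theorem theorem1p1:
  fixes p \<alpha> :: real and a :: "nat \<Rightarrow> complex"
  assumes "(p \<ge> 1.35 \<and> 0 \<le> \<alpha> \<and> \<alpha> \<le> 1) \<or> (p > 1 \<and> 1 / p \<le> \<alpha> \<and> \<alpha> \<le> 1)"
    and "a \<in> lp_seq p"
  shows "weighted_mean \<alpha> a \<in> lp_seq p \<and>
    (\<Sum>\<^sub>\<infinity>n\<in>{1..}. cmod (weighted_mean \<alpha> a n) powr p)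
      \<le> ((\<alpha> + 1) * p / ((\<alpha> + 1) * p - 1)) powr p * (\<Sum>\<^sub>\<infinity>n\<in>{1..}. cmod (a n) powr p)"
proof -
  have p: "p > 1"
    using assms(1) by auto
  then have "1 / p > 0" by simp
  then have \<alpha>: "0 \<le> \<alpha>" "\<alpha> \<le> 1"
    using assms(1) by linarith+
  define B where "B = ((\<alpha> + 1) * p / ((\<alpha> + 1) * p - 1)) powr p * (\<Sum>\<^sub>\<infinity>n\<in>{1..}. cmod (a n) powr p)"
  have a: "(\<lambda>n. cmod (a n) powr p) summable_on {1..}"
    using assms(2) by (simp add: lp_seq_def)
  have "1 * 1 < (\<alpha> + 1) * p"
    using p \<alpha> by (intro mult_le_less_imp_less) auto
  then have l: "1 / ((\<alpha> + 1) * p) < 1" "1 / (1 - 1 / ((\<alpha> + 1) * p)) = (\<alpha> + 1) * p / ((\<alpha> + 1) * p - 1)"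
    by (auto simp: field_simps)
  \<comment> \<open>A bound uniform over finite sets yields both summability and the estimate of the
    infinite sum. Enlarging \<open>F\<close> to \<open>{1..Suc N}\<close> makes the shifted index
    run over \<open>{..N}\<close>.\<close>
  have bound: "(\<Sum>n\<in>F. cmod (weighted_mean \<alpha> a n) powr p) \<le> B" if F: "finite F" "F \<subseteq> {1..}" for F
  proof -
    obtain N where N: "F \<subseteq> {..N}"
      using F finite_nat_set_iff_bounded_le[of F] by auto
    have "(\<Sum>n\<in>F. cmod (weighted_mean \<alpha> a n) powr p) \<le> (\<Sum>n=1..Suc N. cmod (weighted_mean \<alpha> a n) powr p)"
      using F N by (intro sum_mono2) fastforce+
    also have "\<dots> = (\<Sum>n\<le>N. cmod (weighted_mean \<alpha> a (Suc n)) powr p)"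
      by (simp only: One_nat_def sum.atLeast1_atMost_eq lessThan_Suc_atMost)
    also have "\<dots> \<le> (\<Sum>n\<le>N. ((\<Sum>k\<le>n. real (Suc k) powr \<alpha> * cmod (a (Suc k))) / (\<Sum>k\<le>n. real (Suc k) powr \<alpha>)) powr p)"
      using p by (intro sum_mono powr_mono2 cmod_weighted_mean_le) auto
    also have "\<dots> \<le> (1 / (1 - 1 / ((\<alpha> + 1) * p))) powr p * (\<Sum>n\<le>N. cmod (a (Suc n)) powr p)"
      using sum_powr_estimate[OF assms(1)] p l by (intro weighted_mean_sum_le) auto
    also have "(\<Sum>n\<le>N. cmod (a (Suc n)) powr p) = (\<Sum>n=1..Suc N. cmod (a n) powr p)"
      by (simp only: One_nat_def sum.atLeast1_atMost_eq lessThan_Suc_atMost)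
    also have "\<dots> \<le> (\<Sum>\<^sub>\<infinity>n\<in>{1..}. cmod (a n) powr p)"
      using a by (intro finite_sum_le_infsum) auto
    finally show ?thesis
      unfolding B_def l(2) by (simp add: mult_left_mono)
  qed
  then have "(\<lambda>n. cmod (weighted_mean \<alpha> a n) powr p) summable_on {1..}"
    by (intro nonneg_bdd_above_summable_on bdd_aboveI[of _ B]) auto
  then show ?thesis
    using infsum_le_finite_sums[OF _ bound] by (simp add: lp_seq_def B_def)
qed

end
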